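(* Let $n,d$ be positive integers and let $N(n,d)=\binom{n+d-1}{n-1}$. Then $\Sigma_{n,2d}^{k-1}\subsetneqq\Sigma_{n,2d}^{k}$ for every integer $k$ with $2\le k\le N(n,d)$.
   Context: For positive integers $n,d$, $F_{n,d}$ denotes the real vector space of forms (homogeneous polynomials, including $0$) of degree $d$ in $n$ variables $x_1,\dots,x_n$ with real coefficients. $F_{n,d}^k\subset F_{n,d}$ denotes the subset of forms with at most $k$ terms, i.e. with at most $k$ monomials having nonzero coefficient. Define $\Sigma_{n,2d}^k=\left\{\sum_{j=1}^m h_j^2 \ \big|\ m\in\mathbb N,\ h_j\in F_{n,d}^k\right\}\subset F_{n,2d}$. The number $N(n,d)=\binom{n+d-1}{n-1}$ is the number of monomials of degree $d$ in $n$ variables. *)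

theory Defs
  imports Complex_Main "HOL-Library.Poly_Mapping"
begin

text \<open>
  Real polynomials are finitely supported maps from exponent vectors to coefficients, with
  the convolution product of \<^theory>\<open>HOL-Library.Poly_Mapping\<close>. The variables
  $x_1, \dots, x_n$ are indexed by \<open>0, \<dots>, n - 1\<close>.
\<close>

type_synonym real_mpoly = "(nat \<Rightarrow>\<^sub>0 nat) \<Rightarrow>\<^sub>0 real"

definition forms :: "nat \<Rightarrow> nat \<Rightarrow> real_mpoly set" where
  "forms n d = {p. \<forall>m \<in> Poly_Mapping.keys p.
     Poly_Mapping.keys m \<subseteq> {..<n} \<and> (\<Sum>i<n. Poly_Mapping.lookup m i) = d}"

definition sparse_forms :: "nat \<Rightarrow> nat \<Rightarrow> nat \<Rightarrow> real_mpoly set" where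
  "sparse_forms n d k = {p \<in> forms n d. card (Poly_Mapping.keys p) \<le> k}"

text \<open>
  The argument \<open>d\<close> below is the degree of the forms being squared, so that
  \<open>sparse_sos n d k\<close> is $\Sigma_{n,2d}^k$, a set of forms of degree $2d$.
\<close>

definition sparse_sos :: "nat \<Rightarrow> nat \<Rightarrow> nat \<Rightarrow> real_mpoly set" where
  "sparse_sos n d k =
     {(\<Sum>j<m. (h j)\<^sup>2) | (m :: nat) h. \<forall>j<m. h j \<in> sparse_forms n d k}"

definition num_monomials :: "nat \<Rightarrow> nat \<Rightarrow> nat" where
  "num_monomials n d = (n + d - 1) choose (n - 1)"

end

theory Submission
  imports Defs
begin

text \<open>
  Restricting a form to the curve \<open>x\<^sub>i = exp (B ^ i * t)\<close> with \<open>B > d\<close> turns distinct monomials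
  of degree \<open>d\<close> into exponentials with distinct frequencies, and a nonzero combination of \<open>r\<close>
  such exponentials has at most \<open>r - 1\<close> real zeros. Some nonzero form \<open>h\<close> with at most \<open>k\<close> terms
  vanishes on the curve at \<open>t = 0, \<dots>, k - 2\<close>, since this imposes \<open>k - 1\<close> linear conditions on
  \<open>k\<close> coefficients. If \<open>h\<^sup>2\<close> were a sum of squares of forms with at most \<open>k - 1\<close> terms, each of
  them would vanish at the same \<open>k - 1\<close> points, hence be zero, whereas \<open>h\<close> does not vanish at
  \<open>t = k - 1\<close>.
\<close>

subsection \<open>Exponential sums\<close>

text \<open>Induction by Rolle's theorem: dividing by one exponential makes its term constant, so
  differentiation removes that term at the cost of a single zero.\<close>

lemma exp_sum_coeffs_zero:
  fixes c w :: "'a \<Rightarrow> real" and z :: "nat \<Rightarrow> real"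
  assumes "finite A" and "inj_on w A"
    and "\<And>j. Suc j < card A \<Longrightarrow> z j < z (Suc j)"
    and "\<And>j. j < card A \<Longrightarrow> (\<Sum>i\<in>A. c i * exp (w i * z j)) = 0"
  shows "\<forall>i\<in>A. c i = 0"
  using assms
proof (induction A arbitrary: c w z rule: finite_induct)
  case empty
  then show ?case by simp
next
  case (insert a A)
  \<comment> \<open>\<open>g\<close> is the given sum times \<open>exp (- w a * t)\<close>, hence
    has the same zeros. In its derivative the term for \<open>a\<close> carries the factor
    \<open>w a - w a\<close>, so \<open>g'\<close> ranges over \<open>A\<close> only.\<close>
  define g where "g t = (\<Sum>i\<in>insert a A. c i * exp ((w i - w a) * t))" for t
  define g' where "g' t = (\<Sum>i\<in>A. (c i * (w i - w a)) * exp ((w i - w a) * t))" for t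
  have deriv: "(g has_real_derivative g' t) (at t)" for t
  proof -
    have "(g has_real_derivative
        (\<Sum>i\<in>insert a A. (c i * (w i - w a)) * exp ((w i - w a) * t))) (at t)"
      unfolding g_def [abs_def]
      by (intro DERIV_sum) (auto intro!: derivative_eq_intros)
    then show ?thesis
      using insert.hyps by (simp add: g'_def)
  qed
  have g_zero: "g (z j) = 0" if "j < card (insert a A)" for j
  proof -
    have "g (z j) = exp (- w a * z j) * (\<Sum>i\<in>insert a A. c i * exp (w i * z j))"
      unfolding g_def sum_distrib_left
      by (intro sum.cong) (simp_all add: left_diff_distrib exp_diff exp_minus field_simps)
    then show ?thesis
      using insert.prems(3) [OF that] by simp
  qed
  have "\<exists>y. z j < y \<and> y < z (Suc j) \<and> g' y = 0" if "j < card A" for j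
  proof -
    have "z j < z (Suc j)" "g (z j) = g (z (Suc j))"
      using that insert.prems(2) g_zero insert.hyps by auto
    moreover have "continuous_on {z j..z (Suc j)} g"
      using deriv by (intro DERIV_continuous_on) (blast intro: DERIV_subset)
    moreover have "(g has_derivative (\<lambda>v. g' x * v)) (at x)" for x
      using deriv by (simp add: has_field_derivative_def)
    ultimately obtain y where "z j < y" "y < z (Suc j)" "(\<lambda>v. g' y * v) = (\<lambda>v. 0)"
      using Rolle_deriv [of "z j" "z (Suc j)" g "\<lambda>x v. g' x * v"] by blast
    then show ?thesis
      by (metis mult.right_neutral)
  qed
  then obtain y where y: "\<And>j. j < card A \<Longrightarrow> z j < y j \<and> y j < z (Suc j) \<and> g' (y j) = 0"
    by metis
  have "\<forall>i\<in>A. c i * (w i - w a) = 0"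
  proof (rule insert.IH [where w = "\<lambda>i. w i - w a" and z = y])
    show "inj_on (\<lambda>i. w i - w a) A"
      using insert.prems(1) by (auto simp: inj_on_def)
    show "y j < y (Suc j)" if "Suc j < card A" for j
      using y [of j] y [of "Suc j"] that by linarith
    show "(\<Sum>i\<in>A. c i * (w i - w a) * exp ((w i - w a) * y j)) = 0" if "j < card A" for j
      using y [OF that] by (simp add: g'_def)
  qed
  moreover have "w i \<noteq> w a" if "i \<in> A" for i
    using insert.prems(1) insert.hyps(2) that by (auto simp: inj_on_def)
  ultimately have *: "\<forall>i\<in>A. c i = 0"
    by auto
  \<comment> \<open>At \<open>z 0\<close> only the term for \<open>a\<close> is left, and its
    exponential is nonzero.\<close>
  with insert.prems(3) [of 0] insert.hyps have "c a = 0"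
    by simp
  with * show ?case by simp
qed

section \<open>Underdetermined linear systems\<close>

text \<open>Gaussian elimination, by induction on the number of equations.\<close>

lemma homogeneous_system_nontrivial_solution:
  fixes a :: "nat \<Rightarrow> 'b \<Rightarrow> 'a::field"
  assumes "finite S" and "m < card S"
  shows "\<exists>c. (\<exists>i\<in>S. c i \<noteq> 0) \<and> (\<forall>j<m. (\<Sum>i\<in>S. c i * a j i) = 0)"
  using assms
proof (induction m arbitrary: S a)
  case 0
  then obtain i where "i \<in> S" by fastforce
  then show ?case by (intro exI [of _ "\<lambda>_. 1"]) auto
next
  case (Suc m)
  show ?case
  proof (cases "\<forall>i\<in>S. a m i = 0")
    case True
    from Suc.IH [of S a] Suc.prems obtain c
      where "\<exists>i\<in>S. c i \<noteq> 0" "\<forall>j<m. (\<Sum>i\<in>S. c i * a j i) = 0" by auto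
    then show ?thesis
      using True by (intro exI [of _ c]) (auto simp: less_Suc_eq)
  next
    case False
    then obtain p where p: "p \<in> S" "a m p \<noteq> 0" by blast
    define T where "T = S - {p}"
    have T: "S = insert p T" "p \<notin> T" "finite T" "m < card T"
      using p Suc.prems by (auto simp: T_def)
    \<comment> \<open>Subtracting \<open>a j p / a m p\<close> times equation \<open>m\<close> from
      equation \<open>j\<close> eliminates the unknown \<open>p\<close>.\<close>
    obtain c where c: "\<exists>i\<in>T. c i \<noteq> 0"
      "\<And>j. j < m \<Longrightarrow> (\<Sum>i\<in>T. c i * (a j i - a m i * a j p / a m p)) = 0"
      using Suc.IH [of T "\<lambda>j i. a j i - a m i * a j p / a m p"] T by auto
    define s where "s = (\<Sum>i\<in>T. c i * a m i)"
    \<comment> \<open>The value at \<open>p\<close> is the one that solves equation \<open>m\<close>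
      once the other unknowns are fixed.\<close>
    define c' where "c' = c(p := - s / a m p)"
    have eq: "(\<Sum>i\<in>S. c' i * a j i) = - s / a m p * a j p + (\<Sum>i\<in>T. c i * a j i)" for j
    proof -
      have "(\<Sum>i\<in>T. c' i * a j i) = (\<Sum>i\<in>T. c i * a j i)"
        using T(2) by (intro sum.cong) (auto simp: c'_def)
      then show ?thesis
        using T by (simp add: c'_def)
    qed
    have "(\<Sum>i\<in>S. c' i * a j i) = 0" if "j < Suc m" for j
    proof (cases "j = m")
      case True
      then show ?thesis using p by (simp add: eq s_def)
    next
      case False
      with that have "j < m" by simp
      from c(2) [OF this] have "(\<Sum>i\<in>T. c i * a j i) = (\<Sum>i\<in>T. c i * a m i * (a j p / a m p))"
        by (simp add: right_diff_distrib sum_subtractf mult.assoc)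
      also have "\<dots> = s * (a j p / a m p)"
        unfolding s_def by (rule sum_distrib_right [symmetric])
      finally show ?thesis by (simp add: eq)
    qed
    moreover have "\<exists>i\<in>S. c' i \<noteq> 0"
      using c(1) T by (auto simp: c'_def)
    ultimately show ?thesis by blast
  qed
qed

subsection \<open>Evaluation of polynomials at a character of the exponent monoid\<close>

text \<open>A point enters only through the values \<open>\<phi> m\<close> of the monomials there,
  so the curve can be given directly by exponentials in the weights of the monomials.\<close>

definition char_eval :: "('a \<Rightarrow> 'b) \<Rightarrow> ('a \<Rightarrow>\<^sub>0 'b) \<Rightarrow> 'b::comm_semiring_0" where
  "char_eval \<phi> p = (\<Sum>m\<in>Poly_Mapping.keys p. Poly_Mapping.lookup p m * \<phi> m)"

lemma char_eval_superset:
  assumes "finite A" and "Poly_Mapping.keys p \<subseteq> A"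
  shows "char_eval \<phi> p = (\<Sum>m\<in>A. Poly_Mapping.lookup p m * \<phi> m)"
  unfolding char_eval_def
  using assms by (intro sum.mono_neutral_left) (auto simp: in_keys_iff)

lemma char_eval_zero [simp]: "char_eval \<phi> 0 = 0"
  by (simp add: char_eval_def)

lemma char_eval_single [simp]: "char_eval \<phi> (Poly_Mapping.single m c) = c * \<phi> m"
  by (simp add: char_eval_superset [of "{m}"])

lemma char_eval_add: "char_eval \<phi> (p + q) = char_eval \<phi> p + char_eval \<phi> q"
proof -
  let ?A = "Poly_Mapping.keys p \<union> Poly_Mapping.keys q"
  have "char_eval \<phi> (p + q) = (\<Sum>m\<in>?A. Poly_Mapping.lookup (p + q) m * \<phi> m)"
    by (intro char_eval_superset) (auto simp: keys_add)
  also have "\<dots> = (\<Sum>m\<in>?A. Poly_Mapping.lookup p m * \<phi> m) + (\<Sum>m\<in>?A. Poly_Mapping.lookup q m * \<phi> m)"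
    by (simp add: lookup_add distrib_right sum.distrib)
  also have "\<dots> = char_eval \<phi> p + char_eval \<phi> q"
    by (simp add: char_eval_superset [of ?A])
  finally show ?thesis .
qed

lemma char_eval_sum: "char_eval \<phi> (\<Sum>i\<in>I. f i) = (\<Sum>i\<in>I. char_eval \<phi> (f i))"
  by (induction I rule: infinite_finite_induct) (simp_all add: char_eval_add)

lemma poly_mapping_sum_single:
  "p = (\<Sum>m\<in>Poly_Mapping.keys p. Poly_Mapping.single m (Poly_Mapping.lookup p m))"
  by (rule poly_mapping_eqI) (simp add: lookup_sum lookup_single when_def in_keys_iff)

lemma char_eval_mult:
  assumes "\<And>a b. \<phi> (a + b) = \<phi> a * \<phi> b"
  shows "char_eval \<phi> (p * q) = char_eval \<phi> p * char_eval \<phi> q"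
proof -
  let ?t = "\<lambda>p m. Poly_Mapping.single m (Poly_Mapping.lookup p m)"
  have "p * q = (\<Sum>m\<in>Poly_Mapping.keys p. ?t p m) * (\<Sum>m\<in>Poly_Mapping.keys q. ?t q m)"
    using poly_mapping_sum_single [of p] poly_mapping_sum_single [of q] by simp
  also have "\<dots> = (\<Sum>m\<in>Poly_Mapping.keys p. \<Sum>m'\<in>Poly_Mapping.keys q.
      Poly_Mapping.single (m + m') (Poly_Mapping.lookup p m * Poly_Mapping.lookup q m'))"
    by (simp add: sum_product mult_single)
  also have "char_eval \<phi> \<dots> = char_eval \<phi> p * char_eval \<phi> q"
    unfolding char_eval_sum char_eval_single
    by (simp add: assms char_eval_def sum_product mult_ac)
  finally show ?thesis .
qed

subsection \<open>Monomials of given degree\<close>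

definition monomials_of_degree :: "nat \<Rightarrow> nat \<Rightarrow> (nat \<Rightarrow>\<^sub>0 nat) set" where
  "monomials_of_degree n d =
     {m. Poly_Mapping.keys m \<subseteq> {..<n} \<and> (\<Sum>i<n. Poly_Mapping.lookup m i) = d}"

text \<open>The exponents read as digits in base \<open>B\<close>: this is the frequency of the
  monomial along the curve.\<close>

definition monomial_weight :: "nat \<Rightarrow> nat \<Rightarrow> (nat \<Rightarrow>\<^sub>0 nat) \<Rightarrow> real" where
  "monomial_weight n B m = real (\<Sum>i<n. Poly_Mapping.lookup m i * B ^ i)"

lemma forms_altdef: "forms n d = {p. Poly_Mapping.keys p \<subseteq> monomials_of_degree n d}"
  by (auto simp: forms_def monomials_of_degree_def)

lemma monomial_weight_add:
  "monomial_weight n B (a + b) = monomial_weight n B a + monomial_weight n B b"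
  by (simp add: monomial_weight_def lookup_add distrib_right sum.distrib)

text \<open>Reduction modulo \<open>B\<close> isolates the lowest digit; the remaining digits follow
  by induction.\<close>

lemma base_expansion_unique:
  fixes a b :: "nat \<Rightarrow> nat"
  assumes "\<And>i. i < n \<Longrightarrow> a i < B" and "\<And>i. i < n \<Longrightarrow> b i < B"
    and "(\<Sum>i<n. a i * B ^ i) = (\<Sum>i<n. b i * B ^ i)" and "i < n"
  shows "a i = b i"
  using assms
proof (induction n arbitrary: a b i)
  case 0
  then show ?case by simp
next
  case (Suc n)
  have shift: "(\<Sum>i<Suc n. f i * B ^ i) = f 0 + B * (\<Sum>i<n. f (Suc i) * B ^ i)"
    for f :: "nat \<Rightarrow> nat"
    unfolding sum.lessThan_Suc_shift by (simp add: sum_distrib_left mult_ac)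
  have digits: "a 0 < B" "b 0 < B"
    using Suc.prems(1,2) by auto
  have eq: "a 0 + B * (\<Sum>i<n. a (Suc i) * B ^ i) = b 0 + B * (\<Sum>i<n. b (Suc i) * B ^ i)"
    using Suc.prems(3) by (simp only: shift)
  from arg_cong [OF eq, of "\<lambda>x. x mod B"] digits have eq0: "a 0 = b 0"
    by simp
  \<comment> \<open>\<open>a 0 < B\<close> makes \<open>B\<close> positive, so it cancels.\<close>
  with eq digits have "(\<Sum>i<n. a (Suc i) * B ^ i) = (\<Sum>i<n. b (Suc i) * B ^ i)"
    by simp
  then have "a (Suc i') = b (Suc i')" if "i' < n" for i'
    using Suc.IH [of "\<lambda>i. a (Suc i)" "\<lambda>i. b (Suc i)" i'] Suc.prems(1,2) that by auto
  with eq0 Suc.prems(4) show ?case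
    by (cases i) auto
qed

text \<open>No exponent exceeds the degree \<open>d\<close>, so each is a valid digit in base
  \<open>B\<close>.\<close>

lemma inj_on_monomial_weight:
  assumes "d < B"
  shows "inj_on (monomial_weight n B) (monomials_of_degree n d)"
proof (rule inj_onI)
  fix a b
  assume a: "a \<in> monomials_of_degree n d" and b: "b \<in> monomials_of_degree n d"
    and eq: "monomial_weight n B a = monomial_weight n B b"
  have bound: "Poly_Mapping.lookup m i < B" if "m \<in> monomials_of_degree n d" "i < n" for m i
  proof -
    have "Poly_Mapping.lookup m i \<le> (\<Sum>i<n. Poly_Mapping.lookup m i)"
      using that(2) by (intro member_le_sum) auto
    with that assms show ?thesis by (simp add: monomials_of_degree_def)
  qed
  have sums: "(\<Sum>i<n. Poly_Mapping.lookup a i * B ^ i) = (\<Sum>i<n. Poly_Mapping.lookup b i * B ^ i)"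
    using eq unfolding monomial_weight_def of_nat_eq_iff .
  show "a = b"
  proof (rule poly_mapping_eqI)
    fix i
    show "Poly_Mapping.lookup a i = Poly_Mapping.lookup b i"
    proof (cases "i < n")
      case True
      with base_expansion_unique [OF _ _ sums] bound a b show ?thesis by blast
    next
      case False
      with a b have "i \<notin> Poly_Mapping.keys a" "i \<notin> Poly_Mapping.keys b"
        by (auto simp: monomials_of_degree_def)
      then show ?thesis by (simp add: in_keys_iff)
    qed
  qed
qed

text \<open>Exponent vectors are modelled by lists of length \<open>n\<close> with sum
  \<open>d\<close>, which stars and bars counts.\<close>

lemma obtain_monomials_of_degree:
  assumes "1 \<le> n" and "k \<le> num_monomials n d"
  obtains S where "S \<subseteq> monomials_of_degree n d" "finite S" "card S = k"
proof (cases "k = 0")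
  case True
  then show ?thesis using that [of "{}"] by simp
next
  case False
  let ?L = "{l::nat list. length l = n \<and> sum_list l = d}"
  have "num_monomials n d = (d + n - 1) choose d"
    using assms(1) binomial_symmetric [of d "d + n - 1"]
    by (simp add: num_monomials_def add.commute)
  then have "k \<le> card ?L"
    using assms(2) by (simp add: card_length_sum_list)
  then obtain L where L: "L \<subseteq> ?L" "card L = k" "finite L"
    by (rule obtain_subset_with_card_n)
  \<comment> \<open>\<open>Poly_Mapping.nth\<close> forgets trailing zeros, but all lists in
    \<open>L\<close> have the same length.\<close>
  have "inj_on Poly_Mapping.nth L"
  proof (rule inj_onI)
    fix xs ys
    assume *: "xs \<in> L" "ys \<in> L" "Poly_Mapping.nth xs = Poly_Mapping.nth ys"
    with L(1) have len: "length xs = n" "length ys = n" by auto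
    show "xs = ys"
    proof (rule nth_equalityI)
      fix i assume "i < length xs"
      with len *(3) show "xs ! i = ys ! i"
        by (metis lookup_nth nth_default_nth)
    qed (simp add: len)
  qed
  moreover have "Poly_Mapping.nth l \<in> monomials_of_degree n d" if "l \<in> L" for l
  proof -
    from that L(1) have l: "length l = n" "sum_list l = d" by auto
    have "(\<Sum>i<n. nth_default 0 l i) = (\<Sum>i<n. l ! i)"
      using l(1) by (intro sum.cong) (auto simp: nth_default_nth)
    also have "\<dots> = d"
      using l by (simp add: sum_list_sum_nth atLeast0LessThan)
    finally show ?thesis
      using l(1)
      by (auto simp: monomials_of_degree_def in_keys_iff nth_default_def simp del: keys_nth
        split: if_splits)
  qed
  ultimately show ?thesis
    using L by (intro that [of "Poly_Mapping.nth ` L"]) (auto simp: card_image)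
qed

section \<open>A square that is not a sum of squares of sparser forms\<close>

theorem theorem1p2:
  fixes n d k :: nat
  assumes "1 \<le> n" and "1 \<le> d" and "2 \<le> k" and "k \<le> num_monomials n d"
  shows "sparse_sos n d (k - 1) \<subset> sparse_sos n d k"
proof
  have "sparse_forms n d (k - 1) \<subseteq> sparse_forms n d k"
    by (auto simp: sparse_forms_def)
  then show "sparse_sos n d (k - 1) \<subseteq> sparse_sos n d k"
    unfolding sparse_sos_def by blast
next
  \<comment> \<open>\<open>Suc d\<close> is the least base exceeding every possible
    exponent.\<close>
  define w where "w = monomial_weight n (Suc d)"
  define e where "e t = char_eval (\<lambda>m. exp (w m * real t))" for t :: nat
  have w_inj: "inj_on w (monomials_of_degree n d)"
    unfolding w_def by (rule inj_on_monomial_weight) simp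
  have e_square: "e t (p\<^sup>2) = (e t p)\<^sup>2" for t p
    unfolding e_def power2_eq_square
    by (rule char_eval_mult) (simp add: w_def monomial_weight_add distrib_right exp_add)
  \<comment> \<open>As many zeros as terms suffice: the points \<open>0, 1, 2, ...\<close> serve as
    the increasing nodes of the exponential sum.\<close>
  have form_zero: "p = 0"
    if "p \<in> forms n d" "\<And>t. t < card (Poly_Mapping.keys p) \<Longrightarrow> e t p = 0" for p
  proof -
    have "\<forall>m\<in>Poly_Mapping.keys p. Poly_Mapping.lookup p m = 0"
    proof (rule exp_sum_coeffs_zero)
      show "inj_on w (Poly_Mapping.keys p)"
        using w_inj that(1) by (auto simp: forms_altdef intro: inj_on_subset)
      show "real j < real (Suc j)" for j by simp
      show "(\<Sum>m\<in>Poly_Mapping.keys p. Poly_Mapping.lookup p m * exp (w m * real t)) = 0"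
        if "t < card (Poly_Mapping.keys p)" for t
        using \<open>\<And>t. t < card (Poly_Mapping.keys p) \<Longrightarrow> e t p = 0\<close> [OF that]
        by (simp add: e_def char_eval_def)
    qed simp
    then show ?thesis
      by (metis in_keys_iff poly_mapping_eqI lookup_zero)
  qed
  obtain S where S: "S \<subseteq> monomials_of_degree n d" "finite S" "card S = k"
    using obtain_monomials_of_degree assms(1,4) by blast
  obtain c where c: "\<exists>m\<in>S. c m \<noteq> 0"
    "\<forall>t<k - 1. (\<Sum>m\<in>S. c m * exp (w m * real t)) = 0"
    using homogeneous_system_nontrivial_solution [of S "k - 1" "\<lambda>t m. exp (w m * real t)"] S assms(3)
    by auto
  define h where "h = (\<Sum>m\<in>S. Poly_Mapping.single m (c m))"
  have lookup_h: "Poly_Mapping.lookup h m = (if m \<in> S then c m else 0)" for m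
    using S(2) by (simp add: h_def lookup_sum lookup_single when_def)
  have keys_h: "Poly_Mapping.keys h \<subseteq> S"
    by (auto simp: in_keys_iff lookup_h split: if_splits)
  have h: "h \<in> sparse_forms n d k"
    using keys_h S card_mono [OF S(2) keys_h] by (auto simp: sparse_forms_def forms_altdef)
  have h_nonzero: "h \<noteq> 0"
    using c(1) lookup_h by (metis lookup_zero)
  have h_vanishes: "e t h = 0" if "t < k - 1" for t
    using c(2) that by (simp add: e_def h_def char_eval_sum)
  have "h\<^sup>2 \<in> sparse_sos n d k"
    unfolding sparse_sos_def using h
    by (intro CollectI exI [of _ 1] exI [of _ "\<lambda>_. h"]) auto
  moreover have "h\<^sup>2 \<notin> sparse_sos n d (k - 1)"
  proof
    assume "h\<^sup>2 \<in> sparse_sos n d (k - 1)"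
    then obtain r :: nat and f where f: "h\<^sup>2 = (\<Sum>j<r. (f j)\<^sup>2)"
      "\<And>j. j < r \<Longrightarrow> f j \<in> sparse_forms n d (k - 1)"
      unfolding sparse_sos_def by blast
    have e_h: "(e t h)\<^sup>2 = (\<Sum>j<r. (e t (f j))\<^sup>2)" for t
    proof -
      have "e t (\<Sum>j<r. (f j)\<^sup>2) = (\<Sum>j<r. e t ((f j)\<^sup>2))"
        unfolding e_def by (rule char_eval_sum)
      then show ?thesis
        using f(1) by (simp flip: e_square)
    qed
    have "f j = 0" if "j < r" for j
    proof (rule form_zero)
      show "f j \<in> forms n d"
        using f(2) [OF that] by (simp add: sparse_forms_def)
      fix t assume "t < card (Poly_Mapping.keys (f j))"
      with f(2) [OF that] have "t < k - 1"
        by (simp add: sparse_forms_def)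
      \<comment> \<open>A vanishing sum of real squares has only zero summands, so each
        \<open>f j\<close> inherits the zeros of \<open>h\<close>.\<close>
      then have "(\<Sum>j<r. (e t (f j))\<^sup>2) = 0"
        using e_h [of t] h_vanishes by simp
      then show "e t (f j) = 0"
        using that by (simp add: sum_nonneg_eq_0_iff)
    qed
    \<comment> \<open>This now covers \<open>t = k - 1\<close> as well, which gives \<open>h\<close>
      the \<open>k\<close> zeros that its at most \<open>k\<close> terms do not allow.\<close>
    then have "e t h = 0" for t
      using e_h [of t] by (simp add: e_def)
    with form_zero [of h] h h_nonzero show False
      by (simp add: sparse_forms_def)
  qed
  ultimately show "sparse_sos n d (k - 1) \<noteq> sparse_sos n d k"
    by blast
qed

end
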